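(* For all extended processes $A,B$: $A\approx_t B$ if and only if $A\equiv_L B$.
   Context: Applied pi calculus. Fix a signature $\Sigma$ with an equational theory ($\Sigma\vdash M=N$ is equality modulo it). Terms: names, variables, $f(M_1,\dots,M_k)$; ground = variable-free. Plain processes: $0$, $\overline{M}\langle N\rangle.P$, $M(x).P$, $\nu n.P$, $\mathrm{if}\ M=N\ \mathrm{then}\ P\ \mathrm{else}\ Q$, $P+Q$, $P|Q$, $!P$. Extended processes: $P$, $\nu n.A$, $\nu x.A$, $A|B$, and active substitutions $\{M/x\}$. $\mathrm{dom}(A)$ is the set of variables $x$ having an active substitution $\{M/x\}$ in $A$ not under a restriction $\nu x$. Well-formedness: active substitutions cycle-free, $A|B$ only with disjoint domains, $\nu x.A$ only with $x\in\mathrm{dom}(A)$; processes are name-variable-distinct. $A$ is closed if its free variables are exactly $\mathrm{dom}(A)$. Structural equivalence $\equiv$, internal reduction $\to$ (conditionals, choice $P+Q\to P$, communication $\overline{M}\langle N\rangle.P|M(x).Q\to P|Q\{N/x\}$) and labelled transitions with labels $M(N)$ (input) and $\nu x.\overline{M}\langle x\rangle$ (output of a message via fresh alias variable $x$, which adds an active substitution $\{N/x\}$) are the standard ones of the applied pi calculus (Abadi–Fournet); $\mu$ ranges over silent steps and labels, $\xRightarrow{\mu}$ is the weak transition. Static equivalence: $\mathrm{fr}(A)$ replaces every plain process of $A$ by $0$; for $\mathrm{fr}(A)\equiv\nu\tilde n.\sigma$ with $\tilde n$ disjoint from the names of $M,N$, $(M=N)\mathrm{fr}(A)$ iff the variables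 of $M,N$ are in $\mathrm{dom}(A)$ and $\Sigma\vdash M\sigma=N\sigma$. Closed $A\approx_s B$ iff equal domains and $(M=N)\mathrm{fr}(A)\Leftrightarrow(M=N)\mathrm{fr}(B)$ for all $M,N$. Traces: $\mathbf{tr}=A_0\xRightarrow{\mu_1}\cdots\xRightarrow{\mu_n}A_n$ with all $A_i$ closed and $\mathrm{fv}(\mu_i)\subseteq\mathrm{dom}(A_{i-1})$; $|\mathbf{tr}|=n$, $\mathbf{tr}[i]=A_i$, $\mathbf{tr}[i,j]$ the subderivation from $A_i$ to $A_j$; $\mathrm{tr}(A)$ the set of traces of $A$. $\mathbf{tr}\sim_t\mathbf{tr}'$ iff same length, same labels and pointwise statically equivalent processes. Closed $A\subseteq_t B$ iff every trace of $A$ is $\sim_t$ some trace of $B$; $A\approx_t B$ iff both inclusions; for non-closed $A,B$, $A\approx_t B$ iff $A\sigma\approx_t B\sigma$ for all capture-avoiding assignments $\sigma$ of ground terms to the free non-domain variables of $A$ and $B$. Epistemic logic: static formulas $\delta::=\top\mid M_1=M_2\mid M\in\mathrm{dom}\mid\delta_1\vee\delta_2\mid\neg\delta$; modal formulas $\varphi::=\delta\mid\varphi_1\vee\varphi_2\mid\neg\varphi\mid\langle\mu\rangle_-\varphi\mid F\varphi\mid K\varphi$. For $A$, an assignment $\rho$ of ground terms to $\mathrm{fv}(A)\setminus\mathrm{dom}(A)$, $\mathbf{tr}\in\mathrm{tr}(A\rho)$ and $0\le i\le|\mathbf{tr}|$: $\top$ always holds; $A,\rho,\mathbf{tr},i\models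 M_1=M_2$ iff $(M_1\rho=M_2\rho)\mathrm{fr}(\mathbf{tr}[i])$; $M\in\mathrm{dom}$ holds iff $M$ is a variable in $\mathrm{dom}(\mathbf{tr}[i])$; $\vee,\neg$ classical; $\langle\mu\rangle_-\varphi$ iff the step into $\mathbf{tr}[i]$ is $\mathbf{tr}[i-1]\xRightarrow{\mu}\mathbf{tr}[i]$ and $A,\rho,\mathbf{tr},i-1\models\varphi$; $F\varphi$ iff $A,\rho,\mathbf{tr},j\models\varphi$ for some $j\ge i$; $K\varphi$ iff for all assignments $\rho'$ and all $\mathbf{tr}'\in\mathrm{tr}(A\rho')$ with $\mathbf{tr}[0,i]\sim_t\mathbf{tr}'[0,i]$, $A,\rho',\mathbf{tr}',i\models\varphi$. Formulas with further free variables hold iff they hold for all closed-term instances. $A\sqsubseteq_L B$ iff for every $\rho$ and every $\mathbf{tr}\in\mathrm{tr}(A\rho)$ there is $\mathbf{tr}'\in\mathrm{tr}(B\rho)$ such that for all $i$ and all modal $\varphi$: $A,\rho,\mathbf{tr},i\models\varphi\Leftrightarrow B,\rho,\mathbf{tr}',i\models\varphi$. $A\equiv_L B$ iff $A\sqsubseteq_L B$ and $B\sqsubseteq_L A$. *)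

theory Defs
  imports Main
begin

text \<open>
  The applied pi calculus, trace equivalence, and an epistemic logic over traces.

  Processes are taken up to renaming of bound names and variables. This is realised by a locally
  nameless encoding: an occurrence of a name or variable is either free (\<open>Fr\<close>) or a de Bruijn
  index (\<open>Bd\<close>), with separate index spaces for names and for variables. The indices are only
  visible in the raw datatypes. All rules below are written with the named binders \<open>new n A\<close>
  (restriction of a name), \<open>newv x A\<close> (restriction of a variable) and \<open>inp M x P\<close> (input),
  and the predicates \<open>is_term\<close>, \<open>plain\<close> and \<open>ext\<close> carve out the terms and
  the processes generated by the named grammar; these contain no dangling index.
\<close>

section \<open>Terms\<close>

datatype name = Name nat
datatype var = Var nat

datatype 'a atom = Fr 'a | Bd nat

datatype 'f trm =
    Nm "name atom"
  | Vr "var atom"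
  | Fn 'f "'f trm list"

primrec fn_atom :: "'a atom \<Rightarrow> 'a set" where
  "fn_atom (Fr a) = {a}"
| "fn_atom (Bd k) = {}"

primrec close_atom :: "'a \<Rightarrow> nat \<Rightarrow> 'a atom \<Rightarrow> 'a atom" where
  "close_atom a k (Fr b) = (if a = b then Bd k else Fr b)"
| "close_atom a k (Bd j) = Bd j"

primrec fn_trm :: "'f trm \<Rightarrow> name set" where
  "fn_trm (Nm a) = fn_atom a"
| "fn_trm (Vr v) = {}"
| "fn_trm (Fn f Ms) = \<Union> (set (map fn_trm Ms))"

primrec fv_trm :: "'f trm \<Rightarrow> var set" where
  "fv_trm (Nm a) = {}"
| "fv_trm (Vr v) = fn_atom v"
| "fv_trm (Fn f Ms) = \<Union> (set (map fv_trm Ms))"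

primrec closen_trm :: "name \<Rightarrow> nat \<Rightarrow> 'f trm \<Rightarrow> 'f trm" where
  "closen_trm n k (Nm a) = Nm (close_atom n k a)"
| "closen_trm n k (Vr v) = Vr v"
| "closen_trm n k (Fn f Ms) = Fn f (map (closen_trm n k) Ms)"

primrec closev_trm :: "var \<Rightarrow> nat \<Rightarrow> 'f trm \<Rightarrow> 'f trm" where
  "closev_trm x k (Nm a) = Nm a"
| "closev_trm x k (Vr v) = Vr (close_atom x k v)"
| "closev_trm x k (Fn f Ms) = Fn f (map (closev_trm x k) Ms)"

primrec subst_trm :: "(var \<rightharpoonup> 'f trm) \<Rightarrow> 'f trm \<Rightarrow> 'f trm" where
  "subst_trm \<sigma> (Nm a) = Nm a"
| "subst_trm \<sigma> (Vr v) =
     (case v of Fr x \<Rightarrow> (case \<sigma> x of Some N \<Rightarrow> N | None \<Rightarrow> Vr v) | Bd k \<Rightarrow> Vr v)"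
| "subst_trm \<sigma> (Fn f Ms) = Fn f (map (subst_trm \<sigma>) Ms)"

primrec rename_trm :: "(name \<Rightarrow> name) \<Rightarrow> 'f trm \<Rightarrow> 'f trm" where
  "rename_trm \<pi> (Nm a) = Nm (map_atom \<pi> a)"
| "rename_trm \<pi> (Vr v) = Vr v"
| "rename_trm \<pi> (Fn f Ms) = Fn f (map (rename_trm \<pi>) Ms)"

text \<open>A signature is a partial map from symbols to arities, so that it may be empty.\<close>

inductive is_term :: "('f \<rightharpoonup> nat) \<Rightarrow> 'f trm \<Rightarrow> bool" for Sg where
  "is_term Sg (Nm (Fr n))"
| "is_term Sg (Vr (Fr x))"
| "Sg f = Some (length Ms) \<Longrightarrow> (\<And>M. M \<in> set Ms \<Longrightarrow> is_term Sg M) \<Longrightarrow> is_term Sg (Fn f Ms)"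

section \<open>Processes\<close>

text \<open>
  \<open>In M P\<close> and \<open>ResV P\<close> bind variable index 0 in \<open>P\<close> (not in \<open>M\<close>), and \<open>ResN P\<close>
  binds name index 0. \<open>Act M v\<close> is the active substitution of \<open>M\<close> for \<open>v\<close>.
\<close>

datatype 'f proc =
    Stop
  | Out "'f trm" "'f trm" "'f proc"
  | In "'f trm" "'f proc"
  | ResN "'f proc"
  | ResV "'f proc"
  | Cond "'f trm" "'f trm" "'f proc" "'f proc"
  | Choice "'f proc" "'f proc"
  | Par "'f proc" "'f proc"
  | Repl "'f proc"
  | Act "'f trm" "var atom"

primrec fn :: "'f proc \<Rightarrow> name set" where
  "fn Stop = {}"
| "fn (Out M N P) = fn_trm M \<union> fn_trm N \<union> fn P"
| "fn (In M P) = fn_trm M \<union> fn P"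
| "fn (ResN P) = fn P"
| "fn (ResV P) = fn P"
| "fn (Cond M N P Q) = fn_trm M \<union> fn_trm N \<union> fn P \<union> fn Q"
| "fn (Choice P Q) = fn P \<union> fn Q"
| "fn (Par P Q) = fn P \<union> fn Q"
| "fn (Repl P) = fn P"
| "fn (Act M v) = fn_trm M"

primrec fv :: "'f proc \<Rightarrow> var set" where
  "fv Stop = {}"
| "fv (Out M N P) = fv_trm M \<union> fv_trm N \<union> fv P"
| "fv (In M P) = fv_trm M \<union> fv P"
| "fv (ResN P) = fv P"
| "fv (ResV P) = fv P"
| "fv (Cond M N P Q) = fv_trm M \<union> fv_trm N \<union> fv P \<union> fv Q"
| "fv (Choice P Q) = fv P \<union> fv Q"
| "fv (Par P Q) = fv P \<union> fv Q"
| "fv (Repl P) = fv P"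
| "fv (Act M v) = fv_trm M \<union> fn_atom v"

primrec closen :: "name \<Rightarrow> nat \<Rightarrow> 'f proc \<Rightarrow> 'f proc" where
  "closen n k Stop = Stop"
| "closen n k (Out M N P) = Out (closen_trm n k M) (closen_trm n k N) (closen n k P)"
| "closen n k (In M P) = In (closen_trm n k M) (closen n k P)"
| "closen n k (ResN P) = ResN (closen n (Suc k) P)"
| "closen n k (ResV P) = ResV (closen n k P)"
| "closen n k (Cond M N P Q) =
     Cond (closen_trm n k M) (closen_trm n k N) (closen n k P) (closen n k Q)"
| "closen n k (Choice P Q) = Choice (closen n k P) (closen n k Q)"
| "closen n k (Par P Q) = Par (closen n k P) (closen n k Q)"
| "closen n k (Repl P) = Repl (closen n k P)"
| "closen n k (Act M v) = Act (closen_trm n k M) v"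

primrec closev :: "var \<Rightarrow> nat \<Rightarrow> 'f proc \<Rightarrow> 'f proc" where
  "closev x k Stop = Stop"
| "closev x k (Out M N P) = Out (closev_trm x k M) (closev_trm x k N) (closev x k P)"
| "closev x k (In M P) = In (closev_trm x k M) (closev x (Suc k) P)"
| "closev x k (ResN P) = ResN (closev x k P)"
| "closev x k (ResV P) = ResV (closev x (Suc k) P)"
| "closev x k (Cond M N P Q) =
     Cond (closev_trm x k M) (closev_trm x k N) (closev x k P) (closev x k Q)"
| "closev x k (Choice P Q) = Choice (closev x k P) (closev x k Q)"
| "closev x k (Par P Q) = Par (closev x k P) (closev x k Q)"
| "closev x k (Repl P) = Repl (closev x k P)"
| "closev x k (Act M v) = Act (closev_trm x k M) (close_atom x k v)"

text \<open>
  Substitution is capture avoiding whenever the range of \<open>\<sigma>\<close> consists of terms in the sense of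
  \<open>is_term\<close>, since these contain no index. The variable defined by an active substitution is
  left alone: \<open>\<sigma>\<close> is only ever applied to variables outside the domain of the process.
\<close>

primrec subst :: "(var \<rightharpoonup> 'f trm) \<Rightarrow> 'f proc \<Rightarrow> 'f proc" where
  "subst \<sigma> Stop = Stop"
| "subst \<sigma> (Out M N P) = Out (subst_trm \<sigma> M) (subst_trm \<sigma> N) (subst \<sigma> P)"
| "subst \<sigma> (In M P) = In (subst_trm \<sigma> M) (subst \<sigma> P)"
| "subst \<sigma> (ResN P) = ResN (subst \<sigma> P)"
| "subst \<sigma> (ResV P) = ResV (subst \<sigma> P)"
| "subst \<sigma> (Cond M N P Q) =
     Cond (subst_trm \<sigma> M) (subst_trm \<sigma> N) (subst \<sigma> P) (subst \<sigma> Q)"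
| "subst \<sigma> (Choice P Q) = Choice (subst \<sigma> P) (subst \<sigma> Q)"
| "subst \<sigma> (Par P Q) = Par (subst \<sigma> P) (subst \<sigma> Q)"
| "subst \<sigma> (Repl P) = Repl (subst \<sigma> P)"
| "subst \<sigma> (Act M v) = Act (subst_trm \<sigma> M) v"

definition new :: "name \<Rightarrow> 'f proc \<Rightarrow> 'f proc" where
  "new n A = ResN (closen n 0 A)"

definition newv :: "var \<Rightarrow> 'f proc \<Rightarrow> 'f proc" where
  "newv x A = ResV (closev x 0 A)"

definition inp :: "'f trm \<Rightarrow> var \<Rightarrow> 'f proc \<Rightarrow> 'f proc" where
  "inp M x P = In M (closev x 0 P)"

abbreviation asub :: "'f trm \<Rightarrow> var \<Rightarrow> 'f proc" where
  "asub M x \<equiv> Act M (Fr x)"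

text \<open>
  The domain. A restricted variable occurs as an index, hence does not contribute.
\<close>

primrec pdom :: "'f proc \<Rightarrow> var set" where
  "pdom Stop = {}"
| "pdom (Out M N P) = {}"
| "pdom (In M P) = {}"
| "pdom (ResN A) = pdom A"
| "pdom (ResV A) = pdom A"
| "pdom (Cond M N P Q) = {}"
| "pdom (Choice P Q) = {}"
| "pdom (Par A B) = pdom A \<union> pdom B"
| "pdom (Repl P) = {}"
| "pdom (Act M v) = fn_atom v"

text \<open>The frame of a process.\<close>

primrec fr :: "'f proc \<Rightarrow> 'f proc" where
  "fr Stop = Stop"
| "fr (Out M N P) = Stop"
| "fr (In M P) = Stop"
| "fr (ResN A) = ResN (fr A)"
| "fr (ResV A) = ResV (fr A)"
| "fr (Cond M N P Q) = Stop"
| "fr (Choice P Q) = Stop"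
| "fr (Par A B) = Par (fr A) (fr B)"
| "fr (Repl P) = Stop"
| "fr (Act M v) = Act M v"

text \<open>
  \<open>dep A x y\<close>: the value of \<open>x\<close> refers to \<open>y\<close> through one or more active substitutions of
  \<open>A\<close>, possibly by way of restricted variables. A cycle is an instance \<open>dep A x x\<close>.
\<close>

inductive dep :: "'f proc \<Rightarrow> var \<Rightarrow> var \<Rightarrow> bool" where
  "y \<in> fv_trm M \<Longrightarrow> dep (asub M x) x y"
| "dep A x y \<Longrightarrow> dep (Par A B) x y"
| "dep B x y \<Longrightarrow> dep (Par A B) x y"
| "dep A x y \<Longrightarrow> dep (new n A) x y"
| "dep A x y \<Longrightarrow> x \<noteq> z \<Longrightarrow> y \<noteq> z \<Longrightarrow> dep (newv z A) x y"
| "dep A x y \<Longrightarrow> dep A y z \<Longrightarrow> dep A x z"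

section \<open>Labels, formulas and traces as data\<close>

text \<open>
  \<open>AIn M N\<close> is the input label \<open>M(N)\<close>; \<open>AOut x M\<close> is the output label
  on channel \<open>M\<close> that binds the alias \<open>x\<close>. Labels and formulas are parameterised by their
  terms, so that \<open>set_act\<close>, \<open>set_form\<close> collect the free terms and \<open>map_form\<close>
  substitutes in them. In particular, the alias \<open>x\<close> of \<open>AOut x M\<close> is not free.
\<close>

datatype 't act = Tau | AIn 't 't | AOut var 't

primrec bv_act :: "'t act \<Rightarrow> var set" where
  "bv_act Tau = {}"
| "bv_act (AIn M N) = {}"
| "bv_act (AOut x M) = {x}"

definition fv_act :: "'f trm act \<Rightarrow> var set" where
  "fv_act \<mu> = (\<Union>M\<in>set_act \<mu>. fv_trm M)"

definition fn_act :: "'f trm act \<Rightarrow> name set" where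
  "fn_act \<mu> = (\<Union>M\<in>set_act \<mu>. fn_trm M)"

datatype 't sform = Top | Eq 't 't | InDom 't | SOr "'t sform" "'t sform" | SNot "'t sform"

datatype 't form =
    Static "'t sform"
  | Or "'t form" "'t form"
  | Neg "'t form"
  | Prev "'t act" "'t form"
  | Fut "'t form"
  | Know "'t form"

definition fv_form :: "'f trm form \<Rightarrow> var set" where
  "fv_form \<phi> = (\<Union>M\<in>set_form \<phi>. fv_trm M)"

text \<open>A trace: its initial process, and the list of labels paired with the process reached.\<close>

type_synonym 'f trace = "'f proc \<times> ('f trm act \<times> 'f proc) list"

definition len :: "'f trace \<Rightarrow> nat" where
  "len tr = length (snd tr)"

definition state :: "'f trace \<Rightarrow> nat \<Rightarrow> 'f proc" where
  "state tr i = (fst tr # map snd (snd tr)) ! i"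

text \<open>\<open>label tr i\<close> labels the step from \<open>state tr i\<close> to \<open>state tr (Suc i)\<close>.\<close>

definition label :: "'f trace \<Rightarrow> nat \<Rightarrow> 'f trm act" where
  "label tr i = fst (snd tr ! i)"

definition prefix :: "'f trace \<Rightarrow> nat \<Rightarrow> 'f trace" where
  "prefix tr i = (fst tr, take i (snd tr))"

definition trace_dom :: "'f trace \<Rightarrow> var set" where
  "trace_dom tr = (\<Union>i\<le>len tr. pdom (state tr i))"

section \<open>The calculus over a signature with an equational theory\<close>

locale applied_pi =
  fixes Sg :: "'f \<rightharpoonup> nat"
    and E :: "'f trm \<Rightarrow> 'f trm \<Rightarrow> bool"
  assumes E_term: "E M N \<Longrightarrow> is_term Sg M \<and> is_term Sg N"
    and E_refl: "is_term Sg M \<Longrightarrow> E M M"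
    and E_sym: "E M N \<Longrightarrow> E N M"
    and E_trans: "E M N \<Longrightarrow> E N L \<Longrightarrow> E M L"
    and E_cong: "Sg f = Some (length Ms) \<Longrightarrow> list_all2 E Ms Ns \<Longrightarrow> E (Fn f Ms) (Fn f Ns)"
    and E_subst: "E M N \<Longrightarrow> (\<And>T. T \<in> ran \<sigma> \<Longrightarrow> is_term Sg T)
                    \<Longrightarrow> E (subst_trm \<sigma> M) (subst_trm \<sigma> N)"
    and E_rename: "E M N \<Longrightarrow> bij \<pi> \<Longrightarrow> E (rename_trm \<pi> M) (rename_trm \<pi> N)"
begin

definition ground :: "'f trm \<Rightarrow> bool" where
  "ground M \<longleftrightarrow> is_term Sg M \<and> fv_trm M = {}"

inductive plain :: "'f proc \<Rightarrow> bool" where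
  "plain Stop"
| "is_term Sg M \<Longrightarrow> is_term Sg N \<Longrightarrow> plain P \<Longrightarrow> plain (Out M N P)"
| "is_term Sg M \<Longrightarrow> plain P \<Longrightarrow> plain (inp M x P)"
| "plain P \<Longrightarrow> plain (new n P)"
| "is_term Sg M \<Longrightarrow> is_term Sg N \<Longrightarrow> plain P \<Longrightarrow> plain Q \<Longrightarrow> plain (Cond M N P Q)"
| "plain P \<Longrightarrow> plain Q \<Longrightarrow> plain (Choice P Q)"
| "plain P \<Longrightarrow> plain Q \<Longrightarrow> plain (Par P Q)"
| "plain P \<Longrightarrow> plain (Repl P)"

text \<open>
  Well-formed extended processes. Cycles can only be closed by an active substitution or by a
  parallel composition, so they are excluded there.
\<close>

inductive ext :: "'f proc \<Rightarrow> bool" where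
  "plain P \<Longrightarrow> ext P"
| "ext A \<Longrightarrow> ext (new n A)"
| "ext A \<Longrightarrow> x \<in> pdom A \<Longrightarrow> ext (newv x A)"
| "ext A \<Longrightarrow> ext B \<Longrightarrow> pdom A \<inter> pdom B = {} \<Longrightarrow> (\<And>x. \<not> dep (Par A B) x x) \<Longrightarrow> ext (Par A B)"
| "is_term Sg M \<Longrightarrow> x \<notin> fv_trm M \<Longrightarrow> ext (asub M x)"

definition closed :: "'f proc \<Rightarrow> bool" where
  "closed A \<longleftrightarrow> ext A \<and> fv A = pdom A"

subsection \<open>Operational semantics\<close>

inductive struct_axiom :: "'f proc \<Rightarrow> 'f proc \<Rightarrow> bool" where
  str_par_0: "ext A \<Longrightarrow> struct_axiom A (Par A Stop)"
| str_par_assoc: "ext A \<Longrightarrow> ext B \<Longrightarrow> ext C \<Longrightarrow> struct_axiom (Par A (Par B C)) (Par (Par A B) C)"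
| str_par_comm: "ext A \<Longrightarrow> ext B \<Longrightarrow> struct_axiom (Par A B) (Par B A)"
| str_repl: "plain P \<Longrightarrow> struct_axiom (Repl P) (Par P (Repl P))"
| str_new_0: "struct_axiom (new n Stop) Stop"
| str_new_nn: "ext A \<Longrightarrow> struct_axiom (new n (new m A)) (new m (new n A))"
| str_new_nv: "ext A \<Longrightarrow> struct_axiom (new n (newv x A)) (newv x (new n A))"
| str_new_vv: "ext A \<Longrightarrow> struct_axiom (newv x (newv y A)) (newv y (newv x A))"
| str_new_par: "ext A \<Longrightarrow> ext B \<Longrightarrow> n \<notin> fn A \<Longrightarrow> struct_axiom (Par A (new n B)) (new n (Par A B))"
| str_newv_par: "ext A \<Longrightarrow> ext B \<Longrightarrow> x \<notin> fv A \<Longrightarrow> struct_axiom (Par A (newv x B)) (newv x (Par A B))"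
| str_alias: "is_term Sg M \<Longrightarrow> struct_axiom (newv x (asub M x)) Stop"
| str_subst: "is_term Sg M \<Longrightarrow> ext A
    \<Longrightarrow> struct_axiom (Par (asub M x) A) (Par (asub M x) (subst [x \<mapsto> M] A))"
| str_rewrite: "E M N \<Longrightarrow> struct_axiom (asub M x) (asub N x)"

inductive sequiv :: "'f proc \<Rightarrow> 'f proc \<Rightarrow> bool" where
  sequiv_axiom: "struct_axiom A B \<Longrightarrow> ext A \<Longrightarrow> ext B \<Longrightarrow> sequiv A B"
| sequiv_refl: "ext A \<Longrightarrow> sequiv A A"
| sequiv_sym: "sequiv A B \<Longrightarrow> sequiv B A"
| sequiv_trans: "sequiv A B \<Longrightarrow> sequiv B C \<Longrightarrow> sequiv A C"
| sequiv_par: "sequiv A B \<Longrightarrow> ext (Par A C) \<Longrightarrow> ext (Par B C) \<Longrightarrow> ext C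
    \<Longrightarrow> sequiv (Par A C) (Par B C)"
| sequiv_new: "sequiv A B \<Longrightarrow> sequiv (new n A) (new n B)"
| sequiv_newv: "sequiv A B \<Longrightarrow> x \<in> pdom A \<Longrightarrow> x \<in> pdom B \<Longrightarrow> sequiv (newv x A) (newv x B)"

inductive red :: "'f proc \<Rightarrow> 'f proc \<Rightarrow> bool" where
  red_then: "is_term Sg M \<Longrightarrow> plain P \<Longrightarrow> plain Q \<Longrightarrow> red (Cond M M P Q) P"
| red_else: "ground M \<Longrightarrow> ground N \<Longrightarrow> \<not> E M N \<Longrightarrow> plain P \<Longrightarrow> plain Q \<Longrightarrow> red (Cond M N P Q) Q"
| red_left: "plain P \<Longrightarrow> plain Q \<Longrightarrow> red (Choice P Q) P"
| red_right: "plain P \<Longrightarrow> plain Q \<Longrightarrow> red (Choice P Q) Q"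
| red_comm: "is_term Sg M \<Longrightarrow> is_term Sg N \<Longrightarrow> plain P \<Longrightarrow> plain Q
    \<Longrightarrow> red (Par (Out M N P) (inp M x Q)) (Par P (subst [x \<mapsto> N] Q))"
| red_par: "red A A' \<Longrightarrow> ext B \<Longrightarrow> ext (Par A B) \<Longrightarrow> ext (Par A' B)
    \<Longrightarrow> red (Par A B) (Par A' B)"
| red_new: "red A A' \<Longrightarrow> red (new n A) (new n A')"
| red_newv: "red A A' \<Longrightarrow> x \<in> pdom A \<Longrightarrow> x \<in> pdom A' \<Longrightarrow> red (newv x A) (newv x A')"
| red_struct: "sequiv A B \<Longrightarrow> red B B' \<Longrightarrow> sequiv B' A' \<Longrightarrow> red A A'"

inductive lts :: "'f proc \<Rightarrow> 'f trm act \<Rightarrow> 'f proc \<Rightarrow> bool" where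
  lts_in: "is_term Sg M \<Longrightarrow> is_term Sg N \<Longrightarrow> plain P
    \<Longrightarrow> lts (inp M x P) (AIn M N) (subst [x \<mapsto> N] P)"
| lts_out: "is_term Sg M \<Longrightarrow> is_term Sg N \<Longrightarrow> plain P \<Longrightarrow> x \<notin> fv (Out M N P)
    \<Longrightarrow> lts (Out M N P) (AOut x M) (Par P (asub N x))"
| lts_new: "lts A \<mu> A' \<Longrightarrow> n \<notin> fn_act \<mu> \<Longrightarrow> lts (new n A) \<mu> (new n A')"
| lts_newv: "lts A \<mu> A' \<Longrightarrow> x \<notin> fv_act \<mu> \<union> bv_act \<mu> \<Longrightarrow> x \<in> pdom A \<Longrightarrow> x \<in> pdom A'
    \<Longrightarrow> lts (newv x A) \<mu> (newv x A')"
| lts_par: "lts A \<mu> A' \<Longrightarrow> bv_act \<mu> \<inter> fv B = {} \<Longrightarrow> ext B \<Longrightarrow> ext (Par A B) \<Longrightarrow> ext (Par A' B)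
    \<Longrightarrow> lts (Par A B) \<mu> (Par A' B)"
| lts_struct: "sequiv A B \<Longrightarrow> lts B \<mu> B' \<Longrightarrow> sequiv B' A' \<Longrightarrow> lts A \<mu> A'"

text \<open>A weak silent step is any number of reductions, possibly none.\<close>

definition weak :: "'f proc \<Rightarrow> 'f trm act \<Rightarrow> 'f proc \<Rightarrow> bool" where
  "weak A \<mu> B \<longleftrightarrow>
     (if \<mu> = Tau then red\<^sup>*\<^sup>* A B else (red\<^sup>*\<^sup>* OO (\<lambda>C D. lts C \<mu> D) OO red\<^sup>*\<^sup>*) A B)"

subsection \<open>Static equivalence\<close>

definition subst_frame :: "name list \<Rightarrow> (var \<times> 'f trm) list \<Rightarrow> 'f proc" where
  "subst_frame ns s = foldr new ns (foldr (\<lambda>(x, M). Par (asub M x)) s Stop)"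

text \<open>
  \<open>frame_eq A M N\<close> is \<open>(M = N)fr(A)\<close>. As is standard, some presentation of the frame
  in the required form has to equate the two terms.
\<close>

definition frame_eq :: "'f proc \<Rightarrow> 'f trm \<Rightarrow> 'f trm \<Rightarrow> bool" where
  "frame_eq A M N \<longleftrightarrow> fv_trm M \<union> fv_trm N \<subseteq> pdom A \<and>
     (\<exists>ns s. sequiv (fr A) (subst_frame ns s) \<and> set ns \<inter> (fn_trm M \<union> fn_trm N) = {} \<and>
        E (subst_trm (map_of s) M) (subst_trm (map_of s) N))"

definition static_equiv :: "'f proc \<Rightarrow> 'f proc \<Rightarrow> bool" where
  "static_equiv A B \<longleftrightarrow> pdom A = pdom B \<and>
     (\<forall>M N. is_term Sg M \<longrightarrow> is_term Sg N \<longrightarrow> (frame_eq A M N \<longleftrightarrow> frame_eq B M N))"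

subsection \<open>Traces\<close>

definition is_trace :: "'f trace \<Rightarrow> bool" where
  "is_trace tr \<longleftrightarrow> (\<forall>i\<le>len tr. closed (state tr i)) \<and>
     (\<forall>i<len tr. fv_act (label tr i) \<subseteq> pdom (state tr i) \<and>
        weak (state tr i) (label tr i) (state tr (Suc i)))"

definition traces :: "'f proc \<Rightarrow> 'f trace set" where
  "traces A = {tr. is_trace tr \<and> state tr 0 = A}"

definition trace_sim :: "'f trace \<Rightarrow> 'f trace \<Rightarrow> bool" where
  "trace_sim tr tr' \<longleftrightarrow> len tr = len tr' \<and> (\<forall>i<len tr. label tr i = label tr' i) \<and>
     (\<forall>i\<le>len tr. static_equiv (state tr i) (state tr' i))"

definition assignment :: "var set \<Rightarrow> (var \<rightharpoonup> 'f trm) \<Rightarrow> bool" where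
  "assignment V \<rho> \<longleftrightarrow> dom \<rho> = V \<and> (\<forall>N\<in>ran \<rho>. ground N)"

definition params :: "'f proc \<Rightarrow> var set" where
  "params A = fv A - pdom A"

text \<open>
  The instance \<open>A\<rho>\<close>. The restriction to \<open>params A\<close> only matters when \<open>\<rho>\<close> is shared with another
  process having a parameter that belongs to the domain of \<open>A\<close>.
\<close>

definition inst :: "(var \<rightharpoonup> 'f trm) \<Rightarrow> 'f proc \<Rightarrow> 'f proc" where
  "inst \<rho> A = subst (\<rho> |` params A) A"

definition trace_incl_closed :: "'f proc \<Rightarrow> 'f proc \<Rightarrow> bool" where
  "trace_incl_closed A B \<longleftrightarrow> (\<forall>tr\<in>traces A. \<exists>tr'\<in>traces B. trace_sim tr tr')"

definition trace_equiv_closed :: "'f proc \<Rightarrow> 'f proc \<Rightarrow> bool" where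
  "trace_equiv_closed A B \<longleftrightarrow> trace_incl_closed A B \<and> trace_incl_closed B A"

text \<open>If \<open>A\<close> and \<open>B\<close> are closed, the empty assignment is the only one.\<close>

definition trace_equiv :: "'f proc \<Rightarrow> 'f proc \<Rightarrow> bool" where
  "trace_equiv A B \<longleftrightarrow>
     (\<forall>\<rho>. assignment (params A \<union> params B) \<rho> \<longrightarrow> trace_equiv_closed (inst \<rho> A) (inst \<rho> B))"

subsection \<open>Epistemic logic\<close>

primrec sat_static :: "(var \<rightharpoonup> 'f trm) \<Rightarrow> 'f proc \<Rightarrow> 'f trm sform \<Rightarrow> bool" where
  "sat_static \<rho> C Top \<longleftrightarrow> True"
| "sat_static \<rho> C (Eq M N) \<longleftrightarrow> frame_eq C (subst_trm \<rho> M) (subst_trm \<rho> N)"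
| "sat_static \<rho> C (InDom M) \<longleftrightarrow> (\<exists>x\<in>pdom C. M = Vr (Fr x))"
| "sat_static \<rho> C (SOr \<delta>1 \<delta>2) \<longleftrightarrow> sat_static \<rho> C \<delta>1 \<or> sat_static \<rho> C \<delta>2"
| "sat_static \<rho> C (SNot \<delta>) \<longleftrightarrow> \<not> sat_static \<rho> C \<delta>"

text \<open>
  Satisfaction at position \<open>i \<le> len tr\<close>, for a trace \<open>tr\<close> of \<open>inst \<rho> A\<close>. The assignments over
  which \<open>Know\<close> ranges have the same domain as \<open>\<rho>\<close>, which for a process on its own is
  \<open>params A\<close>.
\<close>

primrec sat :: "'f proc \<Rightarrow> (var \<rightharpoonup> 'f trm) \<Rightarrow> 'f trace \<Rightarrow> nat \<Rightarrow> 'f trm form \<Rightarrow> bool" where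
  "sat A \<rho> tr i (Static \<delta>) \<longleftrightarrow> sat_static \<rho> (state tr i) \<delta>"
| "sat A \<rho> tr i (Or \<phi>1 \<phi>2) \<longleftrightarrow> sat A \<rho> tr i \<phi>1 \<or> sat A \<rho> tr i \<phi>2"
| "sat A \<rho> tr i (Neg \<phi>) \<longleftrightarrow> \<not> sat A \<rho> tr i \<phi>"
| "sat A \<rho> tr i (Prev \<mu> \<phi>) \<longleftrightarrow> (\<exists>j. i = Suc j \<and> label tr j = \<mu> \<and> sat A \<rho> tr j \<phi>)"
| "sat A \<rho> tr i (Fut \<phi>) \<longleftrightarrow> (\<exists>j. i \<le> j \<and> j \<le> len tr \<and> sat A \<rho> tr j \<phi>)"
| "sat A \<rho> tr i (Know \<phi>) \<longleftrightarrow>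
     (\<forall>\<rho>'. assignment (dom \<rho>) \<rho>' \<longrightarrow>
        (\<forall>tr'\<in>traces (inst \<rho>' A). i \<le> len tr' \<longrightarrow> trace_sim (prefix tr i) (prefix tr' i)
            \<longrightarrow> sat A \<rho>' tr' i \<phi>))"

text \<open>
  Variables of a formula that are neither assigned by \<open>\<rho>\<close> nor in the domain of any process of the
  trace are implicitly universally quantified over ground terms.
\<close>

definition holds :: "'f proc \<Rightarrow> (var \<rightharpoonup> 'f trm) \<Rightarrow> 'f trace \<Rightarrow> nat \<Rightarrow> 'f trm form \<Rightarrow> bool" where
  "holds A \<rho> tr i \<phi> \<longleftrightarrow>
     (\<forall>\<theta>. assignment (fv_form \<phi> - dom \<rho> - trace_dom tr) \<theta>
        \<longrightarrow> sat A \<rho> tr i (map_form (subst_trm \<theta>) \<phi>))"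

definition logic_incl :: "'f proc \<Rightarrow> 'f proc \<Rightarrow> bool" where
  "logic_incl A B \<longleftrightarrow>
     (\<forall>\<rho>. assignment (params A \<union> params B) \<rho> \<longrightarrow>
        (\<forall>tr\<in>traces (inst \<rho> A). \<exists>tr'\<in>traces (inst \<rho> B).
           \<forall>i \<phi>. i \<le> len tr \<longrightarrow> i \<le> len tr' \<longrightarrow> (\<forall>M\<in>set_form \<phi>. is_term Sg M)
             \<longrightarrow> (holds A \<rho> tr i \<phi> \<longleftrightarrow> holds B \<rho> tr' i \<phi>)))"

definition logic_equiv :: "'f proc \<Rightarrow> 'f proc \<Rightarrow> bool" where
  "logic_equiv A B \<longleftrightarrow> logic_incl A B \<and> logic_incl B A"

end

end

theory Submission
  imports Defs
begin

text \<open>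
  Formulas only see the labels of a trace and its frames up to static equivalence, and the
  quantification in \<open>Know\<close> over similar traces is respected by trace equivalence; this gives one
  direction. Conversely, the formula \<open>Fut\<close> (\<open>Prev\<close> \<dots>) built from all labels of a trace fixes the
  length and the labels of any trace satisfying the same formulas, \<open>InDom\<close> fixes the domains of
  its states, and \<open>Eq\<close> fixes static equivalence, provided that no alias of the trace is a parameter;
  renaming the aliases by a bijection of variables reduces to this case.
\<close>

section \<open>Renaming of free variables\<close>

primrec vren_trm :: "(var \<Rightarrow> var) \<Rightarrow> 'f trm \<Rightarrow> 'f trm" where
  "vren_trm \<pi> (Nm a) = Nm a"
| "vren_trm \<pi> (Vr v) = Vr (map_atom \<pi> v)"
| "vren_trm \<pi> (Fn f Ms) = Fn f (map (vren_trm \<pi>) Ms)"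

text \<open>Unlike \<open>subst\<close>, this also renames the variable defined by an active
  substitution, so domains move along. Bound indices are left alone.\<close>

primrec vren :: "(var \<Rightarrow> var) \<Rightarrow> 'f proc \<Rightarrow> 'f proc" where
  "vren \<pi> Stop = Stop"
| "vren \<pi> (Out M N P) = Out (vren_trm \<pi> M) (vren_trm \<pi> N) (vren \<pi> P)"
| "vren \<pi> (In M P) = In (vren_trm \<pi> M) (vren \<pi> P)"
| "vren \<pi> (ResN P) = ResN (vren \<pi> P)"
| "vren \<pi> (ResV P) = ResV (vren \<pi> P)"
| "vren \<pi> (Cond M N P Q) = Cond (vren_trm \<pi> M) (vren_trm \<pi> N) (vren \<pi> P) (vren \<pi> Q)"
| "vren \<pi> (Choice P Q) = Choice (vren \<pi> P) (vren \<pi> Q)"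
| "vren \<pi> (Par P Q) = Par (vren \<pi> P) (vren \<pi> Q)"
| "vren \<pi> (Repl P) = Repl (vren \<pi> P)"
| "vren \<pi> (Act M v) = Act (vren_trm \<pi> M) (map_atom \<pi> v)"

text \<open>\<open>map_act\<close> would miss the alias of \<open>AOut\<close>, which becomes a
  domain variable of the next state and must be renamed with it.\<close>

primrec vren_act :: "(var \<Rightarrow> var) \<Rightarrow> 'f trm act \<Rightarrow> 'f trm act" where
  "vren_act \<pi> Tau = Tau"
| "vren_act \<pi> (AIn M N) = AIn (vren_trm \<pi> M) (vren_trm \<pi> N)"
| "vren_act \<pi> (AOut x M) = AOut (\<pi> x) (vren_trm \<pi> M)"

definition vren_trace :: "(var \<Rightarrow> var) \<Rightarrow> 'f trace \<Rightarrow> 'f trace" where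
  "vren_trace \<pi> tr = (vren \<pi> (fst tr), map (map_prod (vren_act \<pi>) (vren \<pi>)) (snd tr))"

lemma fn_atom_map_atom: "fn_atom (map_atom f a) = f ` fn_atom a"
  by (cases a) auto

lemma map_atom_cong_fn: "(\<And>x. x \<in> fn_atom a \<Longrightarrow> f x = x) \<Longrightarrow> map_atom f a = a"
  by (cases a) auto

lemma map_atom_close_atom:
  "inj \<pi> \<Longrightarrow> map_atom \<pi> (close_atom x k a) = close_atom (\<pi> x) k (map_atom \<pi> a)"
  by (cases a) (auto dest: injD)

lemma vren_trm_closev: "inj \<pi> \<Longrightarrow> vren_trm \<pi> (closev_trm x k M) = closev_trm (\<pi> x) k (vren_trm \<pi> M)"
  by (induction M) (auto simp: map_atom_close_atom)

lemma vren_trm_closen: "vren_trm \<pi> (closen_trm n k M) = closen_trm n k (vren_trm \<pi> M)"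
  by (induction M) auto

lemma fv_trm_vren [simp]: "fv_trm (vren_trm \<pi> M) = \<pi> ` fv_trm M"
  by (induction M) (auto simp: fn_atom_map_atom)

lemma fn_trm_vren [simp]: "fn_trm (vren_trm \<pi> M) = fn_trm M"
  by (induction M) auto

lemma vren_trm_comp: "vren_trm \<pi> (vren_trm \<rho> M) = vren_trm (\<pi> \<circ> \<rho>) M"
  by (induction M) (auto simp: atom.map_comp o_def)

lemma vren_trm_ident: "(\<And>x. x \<in> fv_trm M \<Longrightarrow> \<pi> x = x) \<Longrightarrow> vren_trm \<pi> M = M"
  by (induction M) (auto simp: map_atom_cong_fn intro!: map_idI)

text \<open>The assumption says that \<open>\<tau>\<close> is \<open>\<sigma>\<close> conjugated by
  \<open>\<pi>\<close>; this form serves both single substitutions and the maps read off from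
  frames.\<close>

lemma vren_trm_subst:
  assumes "\<And>x. \<tau> (\<pi> x) = map_option (vren_trm \<pi>) (\<sigma> x)"
  shows "vren_trm \<pi> (subst_trm \<sigma> M) = subst_trm \<tau> (vren_trm \<pi> M)"
proof (induction M)
  case (Vr v)
  then show ?case using assms by (cases v) (auto split: option.splits)
qed auto

text \<open>A renaming is a substitution by variables, so closure of terms and of \<open>E\<close>
  under substitution carries over to it.\<close>

lemma vren_trm_eq_subst: "vren_trm \<pi> M = subst_trm (\<lambda>x. Some (Vr (Fr (\<pi> x)))) M"
proof (induction M)
  case (Vr v)
  then show ?case by (cases v) auto
qed auto

lemma subst_trm_empty [simp]: "subst_trm Map.empty M = M"
  by (induction M) (auto split: atom.splits intro!: map_idI)

lemma subst_trm_ident: "fv_trm M \<inter> dom \<sigma> = {} \<Longrightarrow> subst_trm \<sigma> M = M"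
proof (induction M)
  case (Vr v)
  then show ?case by (cases v) (auto split: option.splits)
qed (auto intro!: map_idI)

lemma is_term_subst:
  assumes "is_term Sg M" "\<And>N. N \<in> ran \<sigma> \<Longrightarrow> is_term Sg N"
  shows "is_term Sg (subst_trm \<sigma> M)"
  using assms
proof (induction M)
  case (3 f Ms)
  then show ?case by (auto intro!: is_term.intros(3))
qed (auto intro: is_term.intros split: option.splits simp: ran_def)

lemma is_term_vren: "is_term Sg M \<Longrightarrow> is_term Sg (vren_trm \<pi> M)"
  unfolding vren_trm_eq_subst by (rule is_term_subst) (auto simp: ran_def intro: is_term.intros)

text \<open>Injectivity ensures that closing \<open>\<pi> x\<close> binds no variable other than the
  image of \<open>x\<close>.\<close>

lemma vren_closev: "inj \<pi> \<Longrightarrow> vren \<pi> (closev x k P) = closev (\<pi> x) k (vren \<pi> P)"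
  by (induction P arbitrary: k) (auto simp: vren_trm_closev map_atom_close_atom)

lemma vren_closen: "vren \<pi> (closen n k P) = closen n k (vren \<pi> P)"
  by (induction P arbitrary: k) (auto simp: vren_trm_closen)

lemma vren_new [simp]: "vren \<pi> (new n A) = new n (vren \<pi> A)"
  by (simp add: new_def vren_closen)

lemma vren_newv: "inj \<pi> \<Longrightarrow> vren \<pi> (newv x A) = newv (\<pi> x) (vren \<pi> A)"
  by (simp add: newv_def vren_closev)

lemma vren_inp: "inj \<pi> \<Longrightarrow> vren \<pi> (inp M x P) = inp (vren_trm \<pi> M) (\<pi> x) (vren \<pi> P)"
  by (simp add: inp_def vren_closev)

lemma fv_vren [simp]: "fv (vren \<pi> P) = \<pi> ` fv P"
  by (induction P) (auto simp: fn_atom_map_atom)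

lemma fn_vren [simp]: "fn (vren \<pi> P) = fn P"
  by (induction P) auto

lemma pdom_vren [simp]: "pdom (vren \<pi> P) = \<pi> ` pdom P"
  by (induction P) (auto simp: fn_atom_map_atom)

lemma fr_vren [simp]: "fr (vren \<pi> P) = vren \<pi> (fr P)"
  by (induction P) auto

lemma vren_comp: "vren \<pi> (vren \<rho> P) = vren (\<pi> \<circ> \<rho>) P"
  by (induction P) (auto simp: vren_trm_comp atom.map_comp o_def)

lemma vren_ident: "(\<And>x. x \<in> fv P \<Longrightarrow> \<pi> x = x) \<Longrightarrow> vren \<pi> P = P"
  by (induction P) (auto simp: vren_trm_ident map_atom_cong_fn)

lemma vren_subst_single:
  assumes "inj \<pi>"
  shows "vren \<pi> (subst [x \<mapsto> N] P) = subst [\<pi> x \<mapsto> vren_trm \<pi> N] (vren \<pi> P)"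
proof -
  have *: "vren_trm \<pi> (subst_trm [x \<mapsto> N] M) = subst_trm [\<pi> x \<mapsto> vren_trm \<pi> N] (vren_trm \<pi> M)" for M
    by (rule vren_trm_subst) (use assms in \<open>auto dest: injD\<close>)
  show ?thesis by (induction P) (simp_all add: * del: fun_upd_apply)
qed

lemma vren_trm_inv [simp]: "bij \<pi> \<Longrightarrow> vren_trm (inv \<pi>) (vren_trm \<pi> M) = M"
  by (simp add: vren_trm_comp bij_is_inj vren_trm_ident)

lemma vren_trm_inv' [simp]: "bij \<pi> \<Longrightarrow> vren_trm \<pi> (vren_trm (inv \<pi>) M) = M"
  by (simp add: vren_trm_comp bij_is_surj surj_f_inv_f vren_trm_ident)

lemma vren_inv [simp]: "bij \<pi> \<Longrightarrow> vren (inv \<pi>) (vren \<pi> P) = P"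
  by (simp add: vren_comp bij_is_inj vren_ident)

lemma fv_act_vren [simp]: "fv_act (vren_act \<pi> \<mu>) = \<pi> ` fv_act \<mu>"
  by (cases \<mu>) (auto simp: fv_act_def)

lemma fn_act_vren [simp]: "fn_act (vren_act \<pi> \<mu>) = fn_act \<mu>"
  by (cases \<mu>) (auto simp: fn_act_def)

lemma bv_act_vren [simp]: "bv_act (vren_act \<pi> \<mu>) = \<pi> ` bv_act \<mu>"
  by (cases \<mu>) auto

lemma vren_act_eq_Tau [simp]: "vren_act \<pi> \<mu> = Tau \<longleftrightarrow> \<mu> = Tau"
  by (cases \<mu>) auto

lemma vren_act_inv [simp]: "bij \<pi> \<Longrightarrow> vren_act (inv \<pi>) (vren_act \<pi> \<mu>) = \<mu>"
  by (cases \<mu>) (auto simp: bij_is_inj)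

lemma len_vren_trace [simp]: "len (vren_trace \<pi> tr) = len tr"
  by (simp add: len_def vren_trace_def)

lemma state_vren_trace: "i \<le> len tr \<Longrightarrow> state (vren_trace \<pi> tr) i = vren \<pi> (state tr i)"
  by (cases i) (auto simp: state_def len_def vren_trace_def)

lemma label_vren_trace: "i < len tr \<Longrightarrow> label (vren_trace \<pi> tr) i = vren_act \<pi> (label tr i)"
  by (auto simp: label_def len_def vren_trace_def)

lemma trace_dom_vren_trace: "trace_dom (vren_trace \<pi> tr) = \<pi> ` trace_dom tr"
  by (auto simp: trace_dom_def state_vren_trace image_UN)

lemma vren_trace_inv [simp]: "bij \<pi> \<Longrightarrow> vren_trace (inv \<pi>) (vren_trace \<pi> tr) = tr"
  by (cases tr) (auto simp: vren_trace_def intro!: map_idI)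

lemma dep_vren: "dep A x y \<Longrightarrow> inj \<pi> \<Longrightarrow> dep (vren \<pi> A) (\<pi> x) (\<pi> y)"
proof (induction rule: dep.induct)
  case (6 A x y z)
  then show ?case by (blast intro: dep.intros(6))
qed (auto simp: vren_newv inj_eq intro: dep.intros(1-5))

text \<open>Renaming back by the inverse reflects dependencies; absence of cycles needs this
  direction.\<close>

lemma dep_vrenD: "dep (vren \<pi> A) x y \<Longrightarrow> bij \<pi> \<Longrightarrow> dep A (inv \<pi> x) (inv \<pi> y)"
  using dep_vren[of "vren \<pi> A" x y "inv \<pi>"] by (simp add: bij_imp_bij_inv bij_is_inj)

section \<open>Finiteness of variable sets, and bijections avoiding a finite set\<close>

lemma finite_fn_atom [simp]: "finite (fn_atom a)"
  by (cases a) auto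

lemma finite_fv_trm [simp]: "finite (fv_trm M)"
  by (induction M) auto

lemma finite_fv [simp]: "finite (fv P)"
  by (induction P) auto

lemma finite_pdom [simp]: "finite (pdom P)"
  by (induction P) auto

lemma pdom_subst [simp]: "pdom (subst \<sigma> P) = pdom P"
  by (induction P) auto

lemma finite_trace_dom [simp]: "finite (trace_dom tr)"
  by (simp add: trace_dom_def)

text \<open>Shift the avoided variables beyond a common bound of the two sets, and swap them back.\<close>

lemma ex_bij_avoiding:
  fixes S T :: "var set"
  assumes "finite S" "finite T"
  obtains \<pi> where "bij \<pi>" "\<pi> ` T \<inter> S = {}" "\<And>x. x \<in> T \<Longrightarrow> x \<notin> S \<Longrightarrow> \<pi> x = x"
proof -
  have "finite (Var -` (S \<union> T))"
    using assms by (intro finite_vimageI) (auto simp: inj_def)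
  then obtain K where K: "\<And>k. Var k \<in> S \<union> T \<Longrightarrow> k < K"
    by (metis finite_nat_set_iff_bounded vimage_eq)
  define p where "p k = (if Var k \<in> S then k + K
    else if K \<le> k \<and> Var (k - K) \<in> S then k - K else k)" for k
  \<comment> \<open>All indices of \<open>S\<close> and \<open>T\<close> lie below \<open>K\<close>,
    so \<open>Var (k + K)\<close> is never in \<open>S\<close> and \<open>p\<close> is an
    involution.\<close>
  have pp: "p (p k) = k" for k
    using K[of k] K[of "k + K"] K[of "k - K"] by (auto simp: p_def)
  define \<pi> where "\<pi> x = (case x of Var k \<Rightarrow> Var (p k))" for x
  have "\<pi> (\<pi> x) = x" for x by (simp add: \<pi>_def pp split: var.split)
  then have "bij \<pi>" by (metis o_bij comp_apply id_apply ext)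
  moreover have "Var (p k) \<notin> S" if "Var k \<in> T" for k
    using that K[of k] K[of "k + K"] by (auto simp: p_def)
  then have "\<pi> x \<notin> S" if "x \<in> T" for x
    using that by (auto simp: \<pi>_def split: var.split)
  then have "\<pi> ` T \<inter> S = {}" by blast
  moreover have "p k = k" if "Var k \<in> T" "Var k \<notin> S" for k
    using that K[of k] by (auto simp: p_def)
  then have "\<pi> x = x" if "x \<in> T" "x \<notin> S" for x
    using that by (auto simp: \<pi>_def split: var.split)
  ultimately show ?thesis using that by blast
qed

context applied_pi
begin

section \<open>Invariance of well-formedness and of the semantics under bijective renaming\<close>

lemma E_vren: "E M N \<Longrightarrow> E (vren_trm \<pi> M) (vren_trm \<pi> N)"
  unfolding vren_trm_eq_subst by (rule E_subst) (auto simp: ran_def intro: is_term.intros)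

text \<open>The negated equation in \<open>red_else\<close> is preserved only because a bijective
  renaming also reflects \<open>E\<close>.\<close>

lemma E_vrenD: "E (vren_trm \<pi> M) (vren_trm \<pi> N) \<Longrightarrow> bij \<pi> \<Longrightarrow> E M N"
  by (metis E_vren vren_trm_inv)

lemma ground_vren: "ground M \<Longrightarrow> ground (vren_trm \<pi> M)"
  by (simp add: ground_def is_term_vren)

lemma plain_vren: "plain P \<Longrightarrow> inj \<pi> \<Longrightarrow> plain (vren \<pi> P)"
  by (induction rule: plain.induct) (auto simp: vren_inp is_term_vren intro: plain.intros)

lemma ext_vren: "ext A \<Longrightarrow> bij \<pi> \<Longrightarrow> ext (vren \<pi> A)"
proof (induction rule: ext.induct)
  case (4 A B)
  have "\<not> dep (Par (vren \<pi> A) (vren \<pi> B)) x x" for x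
    using dep_vrenD[of \<pi> "Par A B" x x] 4 by auto
  moreover have "pdom (vren \<pi> A) \<inter> pdom (vren \<pi> B) = {}"
    using 4 by (simp add: bij_is_inj flip: image_Int)
  ultimately show ?case using 4 by (simp only: vren.simps) (rule ext.intros(4); simp)
next
  case (5 M x)
  then show ?case
    by (simp add: ext.intros(5) is_term_vren bij_is_inj inj_image_mem_iff)
qed (auto simp: bij_is_inj plain_vren vren_newv intro: ext.intros(1-3))

lemma struct_axiom_vren: "struct_axiom A B \<Longrightarrow> bij \<pi> \<Longrightarrow> struct_axiom (vren \<pi> A) (vren \<pi> B)"
  by (induction rule: struct_axiom.induct)
    (auto simp: bij_is_inj plain_vren ext_vren vren_newv is_term_vren vren_subst_single E_vren
      inj_image_mem_iff intro: struct_axiom.intros)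

lemma sequiv_vren: "sequiv A B \<Longrightarrow> bij \<pi> \<Longrightarrow> sequiv (vren \<pi> A) (vren \<pi> B)"
proof (induction rule: sequiv.induct)
  case (sequiv_par A B C)
  then show ?case
    using ext_vren[of "Par A C" \<pi>] ext_vren[of "Par B C" \<pi>] ext_vren[of C \<pi>]
    by (auto intro: sequiv.sequiv_par)
next
  case (sequiv_trans A B C)
  then show ?case by (blast intro: sequiv.sequiv_trans)
next
  case (sequiv_axiom A B)
  then show ?case by (blast intro: sequiv.sequiv_axiom struct_axiom_vren ext_vren)
next
  case (sequiv_sym A B)
  then show ?case by (blast intro: sequiv.sequiv_sym)
qed (auto simp: bij_is_inj vren_newv ext_vren
  intro: sequiv.sequiv_refl sequiv.sequiv_new sequiv.sequiv_newv)

lemma red_vren: "red A B \<Longrightarrow> bij \<pi> \<Longrightarrow> red (vren \<pi> A) (vren \<pi> B)"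
proof (induction rule: red.induct)
  case (red_par A A' B)
  then show ?case
    using ext_vren[of "Par A B" \<pi>] ext_vren[of "Par A' B" \<pi>] ext_vren[of B \<pi>]
    by (auto intro: red.red_par)
next
  case (red_struct A B B' A')
  then show ?case by (blast intro: red.red_struct sequiv_vren)
next
  case (red_else M N P Q)
  then show ?case
    by (auto simp: plain_vren bij_is_inj ground_vren dest: E_vrenD intro!: red.red_else)
qed (auto simp: bij_is_inj vren_newv vren_inp vren_subst_single plain_vren is_term_vren
  intro: red.red_then red.red_left red.red_right red.red_comm red.red_new red.red_newv)

lemma lts_vren: "lts A \<mu> B \<Longrightarrow> bij \<pi> \<Longrightarrow> lts (vren \<pi> A) (vren_act \<pi> \<mu>) (vren \<pi> B)"
proof (induction rule: lts.induct)
  case (lts_out M N P x)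
  then show ?case
    by (auto simp: bij_is_inj plain_vren is_term_vren inj_image_mem_iff intro!: lts.lts_out)
next
  case (lts_par A \<mu> A' B)
  moreover have "bv_act (vren_act \<pi> \<mu>) \<inter> fv (vren \<pi> B) = {}"
    using lts_par by (simp add: bij_is_inj flip: image_Int)
  ultimately show ?case
    using ext_vren[of "Par A B" \<pi>] ext_vren[of "Par A' B" \<pi>] ext_vren[of B \<pi>]
    by (simp only: vren.simps) (rule lts.lts_par; simp)
next
  case (lts_struct A B \<mu> B' A')
  then show ?case by (blast intro: lts.lts_struct sequiv_vren)
next
  case (lts_newv A \<mu> A' x)
  then show ?case
    by (auto simp: bij_is_inj vren_newv inj_image_mem_iff intro!: lts.lts_newv)
qed (auto simp: bij_is_inj vren_inp vren_subst_single plain_vren is_term_vren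
  intro: lts.lts_in lts.lts_new)

lemma reds_vren: "red\<^sup>*\<^sup>* A B \<Longrightarrow> bij \<pi> \<Longrightarrow> red\<^sup>*\<^sup>* (vren \<pi> A) (vren \<pi> B)"
  by (induction rule: rtranclp_induct) (auto intro: red_vren rtranclp.rtrancl_into_rtrancl)

lemma weak_vren: "weak A \<mu> B \<Longrightarrow> bij \<pi> \<Longrightarrow> weak (vren \<pi> A) (vren_act \<pi> \<mu>) (vren \<pi> B)"
  unfolding weak_def OO_def using reds_vren[of _ _ \<pi>] lts_vren[of _ _ _ \<pi>]
  by (cases "\<mu> = Tau") (simp, simp, blast)

lemma closed_vren: "closed A \<Longrightarrow> bij \<pi> \<Longrightarrow> closed (vren \<pi> A)"
  by (simp add: closed_def ext_vren)

lemma is_trace_vren: "is_trace tr \<Longrightarrow> bij \<pi> \<Longrightarrow> is_trace (vren_trace \<pi> tr)"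
  by (auto simp: is_trace_def state_vren_trace label_vren_trace closed_vren weak_vren
      intro!: image_mono)

section \<open>Invariance of static equivalence and of traces\<close>

lemma vren_subst_frame:
  "vren \<pi> (subst_frame ns s) = subst_frame ns (map (map_prod \<pi> (vren_trm \<pi>)) s)"
proof -
  have "vren \<pi> (foldr (\<lambda>(x, M). Par (asub M x)) s Stop)
      = foldr (\<lambda>(x, M). Par (asub M x)) (map (map_prod \<pi> (vren_trm \<pi>)) s) Stop"
    by (induction s) auto
  then show ?thesis unfolding subst_frame_def by (induction ns) auto
qed

lemma map_of_vren:
  "inj \<pi> \<Longrightarrow> map_of (map (map_prod \<pi> (vren_trm \<pi>)) s) (\<pi> x) = map_option (vren_trm \<pi>) (map_of s x)"
  by (induction s) (auto simp: inj_eq)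

text \<open>Renaming a presentation of the frame gives a presentation of the renamed frame with the
  same restricted names, so freshness for the two terms persists.\<close>

lemma frame_eq_vren:
  assumes "frame_eq A M N" "bij \<pi>"
  shows "frame_eq (vren \<pi> A) (vren_trm \<pi> M) (vren_trm \<pi> N)"
proof -
  obtain ns s where s: "sequiv (fr A) (subst_frame ns s)" "set ns \<inter> (fn_trm M \<union> fn_trm N) = {}"
    "E (subst_trm (map_of s) M) (subst_trm (map_of s) N)"
    and fv: "fv_trm M \<union> fv_trm N \<subseteq> pdom A"
    using assms(1) unfolding frame_eq_def by blast
  let ?s = "map (map_prod \<pi> (vren_trm \<pi>)) s"
  have "vren_trm \<pi> (subst_trm (map_of s) L) = subst_trm (map_of ?s) (vren_trm \<pi> L)" for L
    by (rule vren_trm_subst) (simp add: map_of_vren bij_is_inj assms)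
  then have "E (subst_trm (map_of ?s) (vren_trm \<pi> M)) (subst_trm (map_of ?s) (vren_trm \<pi> N))"
    using E_vren[OF s(3), of \<pi>] by simp
  moreover have "sequiv (fr (vren \<pi> A)) (subst_frame ns ?s)"
    using sequiv_vren[OF s(1) assms(2)] by (simp add: vren_subst_frame)
  ultimately show ?thesis
    unfolding frame_eq_def using s(2) fv by (auto intro!: exI[of _ ns] exI[of _ ?s])
qed

lemma static_equiv_vren:
  assumes "static_equiv A B" "bij \<pi>"
  shows "static_equiv (vren \<pi> A) (vren \<pi> B)"
proof -
  \<comment> \<open>Stated for arbitrary \<open>C\<close> and \<open>D\<close> to serve both
    directions. The test terms are pulled back by \<open>inv \<pi>\<close>, compared there, and
    pushed forward again.\<close>
  have *: "frame_eq (vren \<pi> D) M N"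
    if "frame_eq (vren \<pi> C) M N" "static_equiv C D" "is_term Sg M" "is_term Sg N" for C D M N
  proof -
    have "frame_eq C (vren_trm (inv \<pi>) M) (vren_trm (inv \<pi>) N)"
      using frame_eq_vren[OF that(1) bij_imp_bij_inv[OF assms(2)]] assms(2) by simp
    then have "frame_eq D (vren_trm (inv \<pi>) M) (vren_trm (inv \<pi>) N)"
      using that by (simp add: static_equiv_def is_term_vren)
    from frame_eq_vren[OF this assms(2)] show ?thesis using assms(2) by simp
  qed
  have "static_equiv B A" using assms(1) by (auto simp: static_equiv_def)
  with * assms(1) show ?thesis by (auto simp: static_equiv_def[of "vren \<pi> A"] static_equiv_def[of A])
qed

lemma trace_sim_vren:
  "trace_sim tr tr' \<Longrightarrow> bij \<pi> \<Longrightarrow> trace_sim (vren_trace \<pi> tr) (vren_trace \<pi> tr')"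
  by (auto simp: trace_sim_def state_vren_trace label_vren_trace static_equiv_vren)

text \<open>As the initial process is fixed, only aliases introduced along the trace can change;
  this is what permits choosing them freely.\<close>

lemma traces_vren:
  assumes "tr \<in> traces A" "bij \<pi>" "\<And>x. x \<in> fv A \<Longrightarrow> \<pi> x = x"
  shows "vren_trace \<pi> tr \<in> traces A"
  using assms vren_ident[of A \<pi>] by (auto simp: traces_def is_trace_vren state_vren_trace)

section \<open>Trace equivalence implies logical equivalence\<close>

lemma trace_sim_sym: "trace_sim tr tr' \<Longrightarrow> trace_sim tr' tr"
  by (auto simp: trace_sim_def static_equiv_def)

lemma trace_sim_trans: "trace_sim tr tr' \<Longrightarrow> trace_sim tr' tr'' \<Longrightarrow> trace_sim tr tr''"
  by (auto simp: trace_sim_def static_equiv_def)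

lemma trace_sim_prefix:
  assumes "trace_sim tr tr'" "i \<le> len tr"
  shows "trace_sim (prefix tr i) (prefix tr' i)"
proof -
  have "state (prefix t i) j = state t j" if "j \<le> i" "i \<le> len t" for t :: "'f trace" and j
    using that by (cases j) (auto simp: state_def prefix_def len_def)
  moreover have "label (prefix t i) j = label t j" if "j < i" for t :: "'f trace" and j
    using that by (auto simp: label_def prefix_def)
  moreover have "len (prefix t i) = i" if "i \<le> len t" for t :: "'f trace"
    using that by (auto simp: len_def prefix_def)
  ultimately show ?thesis using assms by (auto simp: trace_sim_def)
qed

lemma trace_sim_trace_dom: "trace_sim tr tr' \<Longrightarrow> trace_dom tr = trace_dom tr'"
  by (auto simp: trace_sim_def trace_dom_def static_equiv_def)

lemma assignment_is_term: "assignment V \<rho> \<Longrightarrow> is_term Sg M \<Longrightarrow> is_term Sg (subst_trm \<rho> M)"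
  by (auto simp: assignment_def ground_def intro: is_term_subst)

lemma sat_static_equiv:
  assumes "static_equiv C D" "assignment V \<rho>" "\<forall>M\<in>set_sform \<delta>. is_term Sg M"
  shows "sat_static \<rho> C \<delta> \<longleftrightarrow> sat_static \<rho> D \<delta>"
  using assms(3)
  by (induction \<delta>) (use assms(1,2) in \<open>auto simp: static_equiv_def assignment_is_term\<close>)

text \<open>Equivalence is assumed for every assignment on \<open>V\<close>, and the induction
  generalises over assignment, traces and position, because \<open>Know\<close> moves to another
  assignment and another trace.\<close>

lemma sat_trace_sim:
  assumes eq: "\<And>\<rho>. assignment V \<rho> \<Longrightarrow> trace_equiv_closed (inst \<rho> A) (inst \<rho> B)"
    and "assignment V \<rho>" "trace_sim tr tr'" "i \<le> len tr" "\<forall>M\<in>set_form \<phi>. is_term Sg M"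
  shows "sat A \<rho> tr i \<phi> \<longleftrightarrow> sat B \<rho> tr' i \<phi>"
  using assms(2-)
proof (induction \<phi> arbitrary: \<rho> tr tr' i)
  case (Static \<delta>)
  then show ?case by (simp add: trace_sim_def sat_static_equiv)
next
  case (Prev \<mu> \<phi>)
  then have "label tr j = label tr' j" "sat A \<rho> tr j \<phi> \<longleftrightarrow> sat B \<rho> tr' j \<phi>" if "i = Suc j" for j
    using that by (auto simp: trace_sim_def)
  then show ?case by auto
next
  case (Fut \<phi>)
  then have "len tr = len tr'" "\<And>j. j \<le> len tr \<Longrightarrow> sat A \<rho> tr j \<phi> \<longleftrightarrow> sat B \<rho> tr' j \<phi>"
    by (auto simp: trace_sim_def)
  then show ?case by auto
next
  case (Know \<phi>)
  have len: "len tr = len tr'" using Know.prems by (simp add: trace_sim_def)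
  have dom: "dom \<rho> = V" using Know.prems by (simp add: assignment_def)
  have pre: "trace_sim (prefix tr i) (prefix tr' i)" using Know.prems trace_sim_prefix by blast
  have IH: "sat A \<rho>' t i \<phi> \<longleftrightarrow> sat B \<rho>' t' i \<phi>"
    if "assignment V \<rho>'" "trace_sim t t'" "i \<le> len t" for \<rho>' t t'
    using Know.IH[OF that] Know.prems by simp
  show ?case
  proof
    assume A: "sat A \<rho> tr i (Know \<phi>)"
    show "sat B \<rho> tr' i (Know \<phi>)"
      unfolding sat.simps
    proof (intro allI ballI impI)
      fix \<rho>' t'
      assume \<rho>': "assignment (dom \<rho>) \<rho>'" and t': "t' \<in> traces (inst \<rho>' B)" "i \<le> len t'"
        and sim: "trace_sim (prefix tr' i) (prefix t' i)"
      \<comment> \<open>An alternative trace of \<open>B\<close> is matched by one of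
        \<open>A\<close>. By transitivity on prefixes it is also an alternative to
        \<open>tr\<close>, so the knowledge of \<open>A\<close> applies to it.\<close>
      obtain t where t: "t \<in> traces (inst \<rho>' A)" "trace_sim t' t"
        using eq[of \<rho>'] \<rho>' t' dom by (auto simp: trace_equiv_closed_def trace_incl_closed_def)
      have "i \<le> len t" using t t' by (simp add: trace_sim_def)
      moreover have "trace_sim (prefix tr i) (prefix t i)"
        using pre sim trace_sim_prefix[OF t(2) t'(2)] trace_sim_trans by blast
      ultimately have "sat A \<rho>' t i \<phi>" using A \<rho>' t by simp
      then show "sat B \<rho>' t' i \<phi>" using IH \<rho>' dom t(2) trace_sim_sym \<open>i \<le> len t\<close> by blast
    qed
  next
    assume B: "sat B \<rho> tr' i (Know \<phi>)"
    show "sat A \<rho> tr i (Know \<phi>)"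
      unfolding sat.simps
    proof (intro allI ballI impI)
      fix \<rho>' t
      assume \<rho>': "assignment (dom \<rho>) \<rho>'" and t: "t \<in> traces (inst \<rho>' A)" "i \<le> len t"
        and sim: "trace_sim (prefix tr i) (prefix t i)"
      obtain t' where t': "t' \<in> traces (inst \<rho>' B)" "trace_sim t t'"
        using eq[of \<rho>'] \<rho>' t dom by (auto simp: trace_equiv_closed_def trace_incl_closed_def)
      have "i \<le> len t'" using t t' by (simp add: trace_sim_def)
      moreover have "trace_sim (prefix tr' i) (prefix t' i)"
        using trace_sim_sym[OF pre] sim trace_sim_prefix[OF t'(2) t(2)] trace_sim_trans by blast
      ultimately have "sat B \<rho>' t' i \<phi>" using B \<rho>' t' by simp
      then show "sat A \<rho>' t i \<phi>" using IH \<rho>' dom t(2) t'(2) by blast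
    qed
  qed
qed auto

lemma trace_equiv_sym: "trace_equiv A B \<Longrightarrow> trace_equiv B A"
  by (auto simp: trace_equiv_def trace_equiv_closed_def Un_commute)

lemma trace_equiv_imp_logic_incl:
  assumes "trace_equiv A B"
  shows "logic_incl A B"
  unfolding logic_incl_def
proof (intro allI ballI impI)
  fix \<rho> tr
  assume \<rho>: "assignment (params A \<union> params B) \<rho>" and tr: "tr \<in> traces (inst \<rho> A)"
  have eq: "trace_equiv_closed (inst \<rho>' A) (inst \<rho>' B)"
    if "assignment (params A \<union> params B) \<rho>'" for \<rho>'
    using assms that by (simp add: trace_equiv_def)
  obtain tr' where tr': "tr' \<in> traces (inst \<rho> B)" "trace_sim tr tr'"
    using eq[OF \<rho>] tr by (auto simp: trace_equiv_closed_def trace_incl_closed_def)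
  have "holds A \<rho> tr i \<phi> \<longleftrightarrow> holds B \<rho> tr' i \<phi>"
    if "i \<le> len tr" "\<forall>M\<in>set_form \<phi>. is_term Sg M" for i \<phi>
  proof -
    \<comment> \<open>Similar traces have equal \<open>trace_dom\<close>, so \<open>holds\<close>
      quantifies over the same \<open>\<theta>\<close> on both sides and it suffices to compare
      \<open>sat\<close> for each.\<close>
    have "sat A \<rho> tr i (map_form (subst_trm \<theta>) \<phi>) \<longleftrightarrow> sat B \<rho> tr' i (map_form (subst_trm \<theta>) \<phi>)"
      if "assignment W \<theta>" for W \<theta>
      by (rule sat_trace_sim[OF eq \<rho> tr'(2) \<open>i \<le> len tr\<close>])
        (use \<open>\<forall>M\<in>set_form \<phi>. is_term Sg M\<close> that
         in \<open>auto simp: form.set_map assignment_is_term\<close>)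
    then show ?thesis
      unfolding holds_def trace_sim_trace_dom[OF tr'(2)] by blast
  qed
  then show "\<exists>tr'\<in>traces (inst \<rho> B). \<forall>i \<phi>. i \<le> len tr \<longrightarrow> i \<le> len tr' \<longrightarrow>
      (\<forall>M\<in>set_form \<phi>. is_term Sg M) \<longrightarrow> (holds A \<rho> tr i \<phi> \<longleftrightarrow> holds B \<rho> tr' i \<phi>)"
    using tr'(1) by blast
qed

section \<open>Logical equivalence implies trace equivalence\<close>

text \<open>The labels are read backwards from the current position. At a position \<open>j\<close>
  beyond \<open>i\<close> the formula concerns the last \<open>i\<close> steps before
  \<open>j\<close>, so there it only witnesses \<open>i \<le> j\<close>.\<close>

primrec history :: "'f trace \<Rightarrow> nat \<Rightarrow> 'f trm form" where
  "history tr 0 = Static Top"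
| "history tr (Suc i) = Prev (label tr i) (history tr i)"

lemma sat_history_le: "sat A \<rho> tr' j (history tr i) \<Longrightarrow> i \<le> j"
  by (induction i arbitrary: j) auto

lemma sat_history: "sat A \<rho> tr' i (history tr i) \<longleftrightarrow> (\<forall>k<i. label tr' k = label tr k)"
  by (induction i) (auto simp: less_Suc_eq)

lemma lts_act_is_term: "lts A \<mu> B \<Longrightarrow> M \<in> set_act \<mu> \<Longrightarrow> is_term Sg M"
  by (induction rule: lts.induct) auto

lemma weak_act_is_term: "weak A \<mu> B \<Longrightarrow> M \<in> set_act \<mu> \<Longrightarrow> is_term Sg M"
  by (auto simp: weak_def OO_def split: if_splits dest: lts_act_is_term)

lemma history_is_term:
  "is_trace tr \<Longrightarrow> i \<le> len tr \<Longrightarrow> M \<in> set_form (history tr i) \<Longrightarrow> is_term Sg M"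
  by (induction i) (auto simp: is_trace_def Suc_le_eq dest: weak_act_is_term)

text \<open>Free variables of a label lie in the domain of the state it leaves, so none of them is
  implicitly quantified by \<open>holds\<close> on \<open>tr\<close>.\<close>

lemma fv_history: "is_trace tr \<Longrightarrow> i \<le> len tr \<Longrightarrow> fv_form (history tr i) \<subseteq> trace_dom tr"
proof (induction i)
  case 0
  then show ?case by (simp add: fv_form_def)
next
  case (Suc i)
  have "fv_form (history tr (Suc i)) = fv_act (label tr i) \<union> fv_form (history tr i)"
    by (auto simp: fv_form_def fv_act_def)
  moreover have "fv_act (label tr i) \<subseteq> trace_dom tr"
    using Suc.prems less_imp_le[of i "len tr"]
    unfolding is_trace_def trace_dom_def Suc_le_eq by blast
  ultimately show ?case using Suc by simp
qed

lemma holds_eq_sat: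
  assumes "fv_form \<phi> \<subseteq> dom \<rho> \<union> trace_dom tr"
  shows "holds A \<rho> tr i \<phi> \<longleftrightarrow> sat A \<rho> tr i \<phi>"
proof -
  have [simp]: "fv_form \<phi> - dom \<rho> - trace_dom tr = {}" using assms by blast
  have "assignment {} \<theta> \<longleftrightarrow> \<theta> = Map.empty" for \<theta>
    by (auto simp: assignment_def)
  moreover have "subst_trm Map.empty = (id :: 'f trm \<Rightarrow> _)" by auto
  ultimately show ?thesis by (simp add: holds_def form.map_id)
qed

text \<open>This covers every \<open>x\<close>: parameters, since \<open>InDom\<close> ignores
  \<open>\<rho>\<close>, and implicitly quantified variables, since these are replaced by ground
  terms, which are never variables.\<close>

lemma holds_trace_dom:
  "holds A \<rho> tr 0 (Fut (Static (InDom (Vr (Fr x))))) \<longleftrightarrow> x \<in> trace_dom tr"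
proof (cases "x \<in> dom \<rho> \<union> trace_dom tr")
  case True
  then have "fv_form (Fut (Static (InDom (Vr (Fr x))))) \<subseteq> dom \<rho> \<union> trace_dom tr"
    by (simp add: fv_form_def)
  then show ?thesis by (subst holds_eq_sat) (auto simp: trace_dom_def)
next
  case False
  \<comment> \<open>A name is a ground term over any signature, even the empty one.\<close>
  let ?\<phi> = "Fut (Static (InDom (Vr (Fr x))))" and ?\<theta> = "[x \<mapsto> Nm (Fr (Name 0))]"
  have "fv_form ?\<phi> - dom \<rho> - trace_dom tr = {x}" using False by (auto simp: fv_form_def)
  then have "assignment (fv_form ?\<phi> - dom \<rho> - trace_dom tr) ?\<theta>"
    by (auto simp: assignment_def ground_def intro: is_term.intros)
  moreover have "\<not> sat A \<rho> tr 0 (map_form (subst_trm ?\<theta>) ?\<phi>)" by auto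
  ultimately show ?thesis using False unfolding holds_def by blast
qed

section \<open>Traces that satisfy the same formulas\<close>

text \<open>The relation between matched traces inside \<open>logic_incl\<close>. Equality of
  lengths is not built in; it has to be derived.\<close>

definition indist ::
  "'f proc \<Rightarrow> 'f proc \<Rightarrow> (var \<rightharpoonup> 'f trm) \<Rightarrow> 'f trace \<Rightarrow> 'f trace \<Rightarrow> bool" where
  "indist A B \<rho> tr tr' \<longleftrightarrow> (\<forall>i \<phi>. i \<le> len tr \<longrightarrow> i \<le> len tr' \<longrightarrow>
     (\<forall>M\<in>set_form \<phi>. is_term Sg M) \<longrightarrow> (holds A \<rho> tr i \<phi> \<longleftrightarrow> holds B \<rho> tr' i \<phi>))"

lemma indist_sym: "indist A B \<rho> tr tr' \<Longrightarrow> indist B A \<rho> tr' tr"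
  by (simp add: indist_def)

lemma indist_holds:
  "indist A B \<rho> tr tr' \<Longrightarrow> i \<le> len tr \<Longrightarrow> i \<le> len tr' \<Longrightarrow> (\<And>M. M \<in> set_form \<phi> \<Longrightarrow> is_term Sg M)
    \<Longrightarrow> holds A \<rho> tr i \<phi> \<longleftrightarrow> holds B \<rho> tr' i \<phi>"
  by (simp add: indist_def)

text \<open>This comes first because \<open>trace_dom\<close> decides which variables
  \<open>holds\<close> quantifies. Once both sides agree on it, \<open>holds\<close> can be replaced
  by \<open>sat\<close>.\<close>

lemma indist_trace_dom:
  assumes "indist A B \<rho> tr tr'"
  shows "trace_dom tr = trace_dom tr'"
proof -
  have "x \<in> trace_dom tr \<longleftrightarrow> x \<in> trace_dom tr'" for x
    using indist_holds[OF assms, of 0 "Fut (Static (InDom (Vr (Fr x))))"]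
    by (auto simp: holds_trace_dom intro: is_term.intros)
  then show ?thesis by blast
qed

lemma indist_sat:
  assumes "indist A B \<rho> tr tr'" "i \<le> len tr" "i \<le> len tr'"
    "\<And>M. M \<in> set_form \<phi> \<Longrightarrow> is_term Sg M" "fv_form \<phi> \<subseteq> trace_dom tr"
  shows "sat A \<rho> tr i \<phi> \<longleftrightarrow> sat B \<rho> tr' i \<phi>"
proof -
  have "fv_form \<phi> \<subseteq> dom \<rho> \<union> trace_dom tr" "fv_form \<phi> \<subseteq> dom \<rho> \<union> trace_dom tr'"
    using assms(5) indist_trace_dom[OF assms(1)] by auto
  then show ?thesis
    using indist_holds[OF assms(1-3), of \<phi>] assms(4) by (simp add: holds_eq_sat)
qed

lemma indist_len_le:
  assumes "indist A B \<rho> tr tr'" "is_trace tr"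
  shows "len tr \<le> len tr'"
proof -
  \<comment> \<open>Position 0 exists in both traces whatever their lengths. In \<open>tr'\<close>
    the formula needs a position that has at least \<open>len tr\<close> steps behind it.\<close>
  let ?\<phi> = "Fut (history tr (len tr))"
  have "sat A \<rho> tr 0 ?\<phi>" by (auto simp: sat_history)
  moreover have "sat A \<rho> tr 0 ?\<phi> \<longleftrightarrow> sat B \<rho> tr' 0 ?\<phi>"
    using history_is_term[OF assms(2)] fv_history[OF assms(2)]
    by (intro indist_sat[OF assms(1)]) (auto simp: fv_form_def)
  ultimately show ?thesis by (auto dest: sat_history_le)
qed

text \<open>For \<open>x\<close> in the common trace domain an \<open>InDom\<close> formula decides
  membership; any other variable lies in no state of either trace.\<close>

lemma indist_pdom:
  assumes "indist A B \<rho> tr tr'" "i \<le> len tr" "i \<le> len tr'"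
  shows "pdom (state tr i) = pdom (state tr' i)"
proof -
  have "x \<in> pdom (state tr i) \<longleftrightarrow> x \<in> pdom (state tr' i)" if "x \<in> trace_dom tr" for x
    using indist_sat[OF assms, of "Static (InDom (Vr (Fr x)))"] that
    by (auto simp: fv_form_def intro: is_term.intros)
  moreover have "pdom (state tr i) \<subseteq> trace_dom tr" "pdom (state tr' i) \<subseteq> trace_dom tr'"
    using assms by (auto simp: trace_dom_def)
  ultimately show ?thesis using indist_trace_dom[OF assms(1)] by blast
qed

lemma indist_imp_trace_sim:
  assumes ind: "indist A B \<rho> tr tr'" and tr: "is_trace tr" "is_trace tr'"
    and disj: "trace_dom tr \<inter> dom \<rho> = {}"
  shows "trace_sim tr tr'"
proof -
  have len: "len tr = len tr'"
    using indist_len_le[OF ind tr(1)] indist_len_le[OF indist_sym[OF ind] tr(2)] by simp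
  have "sat A \<rho> tr (len tr) (history tr (len tr)) \<longleftrightarrow> sat B \<rho> tr' (len tr) (history tr (len tr))"
    using history_is_term[OF tr(1)] fv_history[OF tr(1)] len by (intro indist_sat[OF ind]) auto
  then have lab: "\<forall>k<len tr. label tr k = label tr' k" by (auto simp: sat_history)
  have "static_equiv (state tr i) (state tr' i)" if i: "i \<le> len tr" for i
  proof -
    have dom: "pdom (state tr i) = pdom (state tr' i)" using indist_pdom[OF ind] i len by simp
    have "frame_eq (state tr i) M N \<longleftrightarrow> frame_eq (state tr' i) M N"
      if "is_term Sg M" "is_term Sg N" for M N
    proof (cases "fv_trm M \<union> fv_trm N \<subseteq> pdom (state tr i)")
      case True
      then have fv: "fv_trm M \<union> fv_trm N \<subseteq> trace_dom tr" using i by (auto simp: trace_dom_def)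
      \<comment> \<open>Here \<open>disj\<close> enters: \<open>\<rho>\<close> leaves both terms
        unchanged, so the formula \<open>Eq M N\<close> tests exactly these terms.\<close>
      then have "subst_trm \<rho> M = M" "subst_trm \<rho> N = N"
        using disj by (auto intro!: subst_trm_ident)
      then show ?thesis
        using indist_sat[OF ind i, of "Static (Eq M N)"] fv that len i
        by (auto simp: fv_form_def)
    \<comment> \<open>Terms with variables outside the common domain are equated by neither frame,
      by the definition of \<open>frame_eq\<close>.\<close>
    next
      case False
      then show ?thesis using dom by (auto simp: frame_eq_def)
    qed
    with dom show ?thesis by (simp add: static_equiv_def)
  qed
  with len lab show ?thesis by (simp add: trace_sim_def)
qed

text \<open>
  An alias output along the trace may coincide with a parameter, and then the formulas cannot speak
  about it, since \<open>\<rho>\<close> substitutes for it. Hence the aliases are first renamed apart from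
  \<open>dom \<rho>\<close>, and the matching trace is renamed back.
\<close>

lemma logic_incl_imp_trace_incl:
  assumes incl: "logic_incl A B" and \<rho>: "assignment (params A \<union> params B) \<rho>"
  shows "trace_incl_closed (inst \<rho> A) (inst \<rho> B)"
  unfolding trace_incl_closed_def
proof
  fix tr assume tr: "tr \<in> traces (inst \<rho> A)"
  have ex: "\<exists>t'\<in>traces (inst \<rho> B). indist A B \<rho> t t'" if "t \<in> traces (inst \<rho> A)" for t
    using incl \<rho> that unfolding logic_incl_def indist_def by blast
  have dom\<rho>: "dom \<rho> = params A \<union> params B" using \<rho> by (simp add: assignment_def)
  have start: "fv C = pdom C" "pdom C \<subseteq> trace_dom t" if "t \<in> traces C" for C t
    using that by (auto simp: traces_def is_trace_def closed_def trace_dom_def)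
  \<comment> \<open>The match of the original trace serves only to show that \<open>A\<close> and
    \<open>B\<close> have the same domain, so that no variable of it is a parameter of either
    process.\<close>
  obtain t0 where t0: "t0 \<in> traces (inst \<rho> B)" "indist A B \<rho> tr t0" using ex[OF tr] by blast
  have pdom: "pdom A = pdom B"
    using indist_pdom[OF t0(2), of 0] tr t0(1) by (simp add: traces_def inst_def)
  obtain \<pi> where \<pi>: "bij \<pi>" "\<pi> ` trace_dom tr \<inter> dom \<rho> = {}"
    and fix_\<pi>: "\<And>x. x \<in> trace_dom tr \<Longrightarrow> x \<notin> dom \<rho> \<Longrightarrow> \<pi> x = x"
    using ex_bij_avoiding[of "dom \<rho>" "trace_dom tr"] by (auto simp: dom\<rho> params_def)
  \<comment> \<open>Domain variables of \<open>A\<close> are not in \<open>dom \<rho>\<close>, so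
    \<open>\<pi>\<close> fixes them and the renamed trace still starts at
    \<open>inst \<rho> A\<close>.\<close>
  have fix_pdom: "\<pi> x = x" if "x \<in> pdom A" for x
    using fix_\<pi>[of x] start(2)[OF tr] that pdom by (auto simp: dom\<rho> params_def inst_def)
  let ?t = "vren_trace \<pi> tr"
  have t: "?t \<in> traces (inst \<rho> A)"
    using traces_vren[OF tr \<pi>(1)] fix_pdom start(1)[OF tr] by (simp add: inst_def)
  then obtain t' where t': "t' \<in> traces (inst \<rho> B)" "indist A B \<rho> ?t t'" using ex by blast
  have "trace_sim ?t t'"
    using indist_imp_trace_sim[OF t'(2)] t t'(1) \<pi>(2)
    by (simp add: traces_def trace_dom_vren_trace)
  then have "trace_sim tr (vren_trace (inv \<pi>) t')"
    using trace_sim_vren[of ?t t' "inv \<pi>"] \<pi>(1) by (simp add: bij_imp_bij_inv)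
  \<comment> \<open>The free variables of \<open>inst \<rho> B\<close> are its domain, which is that
    of \<open>A\<close>; hence renaming back yields a trace of the same process.\<close>
  moreover have "inv \<pi> x = x" if "x \<in> fv (inst \<rho> B)" for x
  proof -
    have "\<pi> x = x" using that fix_pdom start(1)[OF t'(1)] pdom by (simp add: inst_def)
    then show ?thesis using \<pi>(1) by (metis bij_inv_eq_iff)
  qed
  then have "vren_trace (inv \<pi>) t' \<in> traces (inst \<rho> B)"
    using traces_vren[OF t'(1) bij_imp_bij_inv[OF \<pi>(1)]] by blast
  ultimately show "\<exists>tr'\<in>traces (inst \<rho> B). trace_sim tr tr'" by blast
qed

lemma trace_equiv_iff_logic_equiv: "trace_equiv A B \<longleftrightarrow> logic_equiv A B"
proof
  assume "trace_equiv A B"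
  then show "logic_equiv A B"
    by (simp add: logic_equiv_def trace_equiv_imp_logic_incl trace_equiv_sym)
next
  assume "logic_equiv A B"
  then show "trace_equiv A B"
    using logic_incl_imp_trace_incl[of A B] logic_incl_imp_trace_incl[of B A]
    by (auto simp: logic_equiv_def trace_equiv_def trace_equiv_closed_def Un_commute)
qed

end

theorem theorem4p9:
  fixes Sg :: "'f \<rightharpoonup> nat"
    and E :: "'f trm \<Rightarrow> 'f trm \<Rightarrow> bool"
    and A B :: "'f proc"
  assumes "applied_pi Sg E"
    and "applied_pi.ext Sg A"
    and "applied_pi.ext Sg B"
  shows "applied_pi.trace_equiv Sg E A B \<longleftrightarrow> applied_pi.logic_equiv Sg E A B"
  by (rule applied_pi.trace_equiv_iff_logic_equiv[OF assms(1)])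

end
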